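(* Let $k\ge 2$ and $p\ge 2$ be integers and let $n_1,\dots,n_p$ be positive integers. The complete multipartite graph $K_{n_1,n_2,\dots,n_p}$ admits a neighborhood-balanced $k$-coloring if and only if $n_i\equiv 0\pmod k$ for every $i=1,2,\dots,p$.
   Context: A neighborhood-balanced $k$-coloring of a graph is a (not necessarily proper) vertex coloring with colors $1,\dots,k$ such that every vertex has the same number of neighbors of each of the $k$ colors. *)

theory Defs
  imports
    "Graph_Theory.Pair_Digraph"
    "HOL-Number_Theory.Cong"
    "HOL-Library.Disjoint_Sets"
begin

text \<open>
  Finite simple graphs are the finite, symmetric, loop-free digraphs without multiple arcs of the
  locale \<^locale>\<open>graph\<close>, so \<open>u \<rightarrow>\<^bsub>G\<^esub> v\<close> is adjacency.
\<close>

definition neighborhood :: "('a, 'b) pre_digraph \<Rightarrow> 'a \<Rightarrow> 'a set" where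
  "neighborhood G v = {w. v \<rightarrow>\<^bsub>G\<^esub> w}"

text \<open>
  The colors are exactly \<open>1, \<dots>, k\<close>; properness is not required, and a color may be unused.
\<close>

definition neighborhood_balanced_coloring ::
  "('a, 'b) pre_digraph \<Rightarrow> nat \<Rightarrow> ('a \<Rightarrow> nat) \<Rightarrow> bool" where
  "neighborhood_balanced_coloring G k c \<longleftrightarrow>
     c \<in> verts G \<rightarrow> {1..k} \<and>
     (\<forall>v\<in>verts G. \<forall>a\<in>{1..k}. \<forall>b\<in>{1..k}.
        card {w \<in> neighborhood G v. c w = a} = card {w \<in> neighborhood G v. c w = b})"

text \<open>
  \<open>G\<close> is a copy of \<open>K\<^bsub>n 1, \<dots>, n p\<^esub>\<close>. As for the predicates \<open>K\<^bsub>n\<^esub>\<close> and \<open>K\<^bsub>m,n\<^esub>\<close> in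
  theory \<open>Kuratowski\<close> of \<open>Graph_Theory\<close>, this determines \<open>G\<close> up to isomorphism only.
\<close>

definition complete_multipartite_digraph ::
  "nat \<Rightarrow> (nat \<Rightarrow> nat) \<Rightarrow> ('a, 'b) pre_digraph \<Rightarrow> bool" where
  "complete_multipartite_digraph p n G \<longleftrightarrow> graph G \<and>
     (\<exists>V. verts G = (\<Union>i\<in>{1..p}. V i) \<and> disjoint_family_on V {1..p} \<and>
          (\<forall>i\<in>{1..p}. card (V i) = n i) \<and>
          arcs_ends G = (\<Union>i\<in>{1..p}. \<Union>j\<in>{1..p} - {i}. V i \<times> V j))"

lemma complete_multipartite_digraph_exists:
  "\<exists>G :: (nat \<times> nat) pair_pre_digraph. complete_multipartite_digraph p n (with_proj G)"
proof -
  define V where "V i = {i} \<times> {..<n i}" for i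
  define G where "G = \<lparr>pverts = (\<Union>i\<in>{1..p}. V i),
    parcs = (\<Union>i\<in>{1..p}. \<Union>j\<in>{1..p} - {i}. V i \<times> V j)\<rparr>"
  interpret pair_graph G
    by unfold_locales (auto simp: G_def V_def symmetric_def intro!: symI)
  have "graph (with_proj G)" by unfold_locales
  then show ?thesis
    unfolding complete_multipartite_digraph_def
    by (intro exI[of _ G] conjI exI[of _ V])
      (auto simp: G_def V_def disjoint_family_on_def)
qed

end

theory Submission
  imports Defs
begin

text \<open>
  Fix a coloring, and let \<open>x\<^sub>i a\<close> count the vertices of color \<open>a\<close> in the part \<open>V\<^sub>i\<close>. A vertex of
  \<open>V\<^sub>i\<close> sees everything outside \<open>V\<^sub>i\<close>, so balance at that vertex says that \<open>\<Sum>\<^sub>j x\<^sub>j a - x\<^sub>i a\<close> is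
  independent of \<open>a\<close>. Hence for two colors \<open>a\<close> and \<open>b\<close> the difference \<open>x\<^sub>i a - x\<^sub>i b\<close> equals the
  total difference \<open>d = \<Sum>\<^sub>j (x\<^sub>j a - x\<^sub>j b)\<close> for every \<open>i\<close>; summing over the \<open>p\<close> parts gives
  \<open>d = p d\<close>, and \<open>d = 0\<close> because \<open>p \<noteq> 1\<close> (\<open>eq_if_sums_omitting_one_eq\<close>). So the colors are equally
  frequent inside each single part, which makes the size of the part a multiple of \<open>k\<close>
  (\<open>card_eq_if_color_classes_equal\<close>).

  Conversely, if \<open>k\<close> divides the size of every part, color each part separately with all colors
  equally frequent (\<open>ex_equal_color_classes\<close>). A neighborhood is a disjoint union of parts, so it
  inherits the balance.
\<close>

text \<open>
  Omitting \<open>i\<close> from a sum and comparing shows that \<open>x i - y i\<close> is the total difference \<open>d\<close>,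
  independently of \<open>i\<close>; then \<open>d = card I * d\<close>. A singleton \<open>I\<close> would leave only empty sums.
\<close>

lemma eq_if_sums_omitting_one_eq:
  fixes x y :: "'i \<Rightarrow> nat"
  assumes fin: "finite I" and card: "card I \<noteq> 1"
    and eq: "\<And>i. i \<in> I \<Longrightarrow> (\<Sum>j\<in>I - {i}. x j) = (\<Sum>j\<in>I - {i}. y j)"
    and "i \<in> I"
  shows "x i = y i"
proof -
  define d where "d = (\<Sum>j\<in>I. int (x j) - int (y j))"
  have diff: "int (x j) - int (y j) = d" if "j \<in> I" for j
  proof -
    have "d = int (x j) - int (y j) + (\<Sum>l\<in>I - {j}. int (x l) - int (y l))"
      unfolding d_def by (rule sum.remove[OF fin that])
    moreover have "(\<Sum>l\<in>I - {j}. int (x l) - int (y l)) = 0"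
      using eq[OF that] by (simp add: sum_subtractf flip: of_nat_sum)
    ultimately show ?thesis by simp
  qed
  have "d = int (card I) * d"
    using diff by (subst d_def) simp
  then have "d = 0"
    using card by simp
  then show ?thesis
    using diff[OF \<open>i \<in> I\<close>] by simp
qed

lemma card_eq_if_color_classes_equal:
  assumes "finite A" and "c \<in> A \<rightarrow> {1..k}"
    and "\<And>a. a \<in> {1..k} \<Longrightarrow> card {w \<in> A. c w = a} = m"
  shows "card A = k * m"
proof -
  have "card A = (\<Sum>a\<in>{1..k}. card {w \<in> A. c w = a})"
    using sum.group[of A "{1..k}" c "\<lambda>_. 1 :: nat"] assms(1,2)
    by (simp add: image_subset_iff_funcset)
  then show ?thesis
    using assms(3) by simp
qed

text \<open>
  A set of \<open>m * k\<close> elements can be identified with a grid of \<open>m\<close> rows and \<open>k\<close> columns; the column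
  is the color.
\<close>

lemma ex_equal_color_classes:
  assumes "finite A" and "card A = m * k"
  obtains c where "c \<in> A \<rightarrow> {1..k}" and "\<And>a. a \<in> {1..k} \<Longrightarrow> card {w \<in> A. c w = a} = m"
proof -
  have "card A = card ({..<m} \<times> {1..k})"
    using assms(2) by (simp add: card_cartesian_product)
  then obtain h where h: "bij_betw h A ({..<m} \<times> {1..k})"
    using finite_same_card_bij[OF assms(1), of "{..<m} \<times> {1..k}"] by auto
  have "snd \<circ> h \<in> A \<rightarrow> {1..k}"
    using bij_betw_apply[OF h] by fastforce
  moreover have "card {w \<in> A. (snd \<circ> h) w = a} = m" if "a \<in> {1..k}" for a
  proof -
    have "h ` {w \<in> A. (snd \<circ> h) w = a} = {z \<in> h ` A. snd z = a}"
      by auto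
    also have "\<dots> = {..<m} \<times> {a}"
      using that bij_betw_imp_surj_on[OF h] by auto
    finally have "bij_betw h {w \<in> A. (snd \<circ> h) w = a} ({..<m} \<times> {a})"
      by (intro bij_betw_subset[OF h]) auto
    from bij_betw_same_card[OF this] show ?thesis
      by (simp add: card_cartesian_product)
  qed
  ultimately show ?thesis
    using that by blast
qed

theorem theorem4p2:
  fixes G :: "('a, 'b) pre_digraph" and k p :: nat and n :: "nat \<Rightarrow> nat"
  assumes "k \<ge> 2" and "p \<ge> 2"
    and "\<And>i. i \<in> {1..p} \<Longrightarrow> n i > 0"
    and "complete_multipartite_digraph p n G"
  shows "(\<exists>c. neighborhood_balanced_coloring G k c) \<longleftrightarrow> (\<forall>i\<in>{1..p}. [n i = 0] (mod k))"
proof -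
  from assms(4) obtain V where "graph G"
    and verts: "verts G = (\<Union>i\<in>{1..p}. V i)"
    and disj: "disjoint_family_on V {1..p}"
    and cardV: "\<And>i. i \<in> {1..p} \<Longrightarrow> card (V i) = n i"
    and ends: "arcs_ends G = (\<Union>i\<in>{1..p}. \<Union>j\<in>{1..p} - {i}. V i \<times> V j)"
    unfolding complete_multipartite_digraph_def by blast
  interpret graph G by fact
  have finV: "finite (V i)" if "i \<in> {1..p}" for i
    using finite_verts that unfolding verts by simp
  have same_part: "i = j" if "i \<in> {1..p}" "j \<in> {1..p}" "v \<in> V i" "v \<in> V j" for i j v
    using disj that unfolding disjoint_family_on_def by blast
  have nbh: "neighborhood G v = (\<Union>j\<in>{1..p} - {i}. V j)" if "i \<in> {1..p}" "v \<in> V i" for i v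
    using same_part that unfolding neighborhood_def ends by blast
  have count: "card {w \<in> neighborhood G v. c w = a}
      = (\<Sum>j\<in>{1..p} - {i}. card {w \<in> V j. c w = a})"
    if "i \<in> {1..p}" "v \<in> V i" for i v a and c :: "'a \<Rightarrow> nat"
  proof -
    have "{w \<in> neighborhood G v. c w = a} = (\<Union>j\<in>{1..p} - {i}. {w \<in> V j. c w = a})"
      unfolding nbh[OF that] by blast
    also have "card \<dots> = (\<Sum>j\<in>{1..p} - {i}. card {w \<in> V j. c w = a})"
      using finV same_part by (intro card_UN_disjoint) auto
    finally show ?thesis .
  qed
  show ?thesis
  proof
    assume "\<exists>c. neighborhood_balanced_coloring G k c"
    then obtain c where c: "c \<in> verts G \<rightarrow> {1..k}"
      and bal: "\<And>v a b. v \<in> verts G \<Longrightarrow> a \<in> {1..k} \<Longrightarrow> b \<in> {1..k} \<Longrightarrow>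
        card {w \<in> neighborhood G v. c w = a} = card {w \<in> neighborhood G v. c w = b}"
      unfolding neighborhood_balanced_coloring_def by blast
    have part_bal: "card {w \<in> V i. c w = a} = card {w \<in> V i. c w = b}"
      if i: "i \<in> {1..p}" and ab: "a \<in> {1..k}" "b \<in> {1..k}" for i a b
    proof (rule eq_if_sums_omitting_one_eq[OF _ _ _ i])
      fix l assume l: "l \<in> {1..p}"
      \<comment> \<open>The balance condition speaks about the part \<open>l\<close> only through a vertex in it.\<close>
      obtain v where v: "v \<in> V l"
        using cardV[OF l] assms(3)[OF l] by fastforce
      have "v \<in> verts G"
        using v l verts by blast
      from bal[OF this ab] show "(\<Sum>j\<in>{1..p} - {l}. card {w \<in> V j. c w = a})
          = (\<Sum>j\<in>{1..p} - {l}. card {w \<in> V j. c w = b})"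
        by (simp only: count[OF l v])
    qed (use assms(2) in auto)
    show "\<forall>i\<in>{1..p}. [n i = 0] (mod k)"
    proof
      fix i assume i: "i \<in> {1..p}"
      have "card (V i) = k * card {w \<in> V i. c w = 1}"
      proof (rule card_eq_if_color_classes_equal[OF finV[OF i]])
        show "c \<in> V i \<rightarrow> {1..k}"
          using c i verts by blast
        show "card {w \<in> V i. c w = a} = card {w \<in> V i. c w = 1}" if "a \<in> {1..k}" for a
          using part_bal[OF i that] assms(1) by simp
      qed
      then show "[n i = 0] (mod k)"
        using cardV[OF i] by (simp add: cong_0_iff)
    qed
  next
    assume dvd: "\<forall>i\<in>{1..p}. [n i = 0] (mod k)"
    have "\<exists>f. f \<in> V i \<rightarrow> {1..k} \<and> (\<forall>a\<in>{1..k}. card {w \<in> V i. f w = a} = n i div k)"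
      if i: "i \<in> {1..p}" for i
    proof -
      have "card (V i) = n i div k * k"
        using dvd cardV[OF i] i by (simp add: cong_0_iff)
      from ex_equal_color_classes[OF finV[OF i] this] show ?thesis
        by metis
    qed
    then obtain f where f: "\<And>i. i \<in> {1..p} \<Longrightarrow> f i \<in> V i \<rightarrow> {1..k}"
      and f_classes: "\<And>i a. i \<in> {1..p} \<Longrightarrow> a \<in> {1..k} \<Longrightarrow> card {w \<in> V i. f i w = a} = n i div k"
      by metis
    define part where "part w = (THE i. i \<in> {1..p} \<and> w \<in> V i)" for w
    have part: "part w = i" if "i \<in> {1..p}" "w \<in> V i" for i w
      unfolding part_def
    proof (rule the_equality)
      show "j = i" if "j \<in> {1..p} \<and> w \<in> V j" for j
        using that same_part[OF _ \<open>i \<in> {1..p}\<close> _ \<open>w \<in> V i\<close>] by simp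
    qed (use that in simp)
    define c where "c w = f (part w) w" for w
    have c: "c \<in> verts G \<rightarrow> {1..k}"
      using f part unfolding c_def verts by fastforce
    have "{w \<in> V i. c w = a} = {w \<in> V i. f i w = a}" if "i \<in> {1..p}" for i a
      using part[OF that] unfolding c_def by auto
    then have classes: "card {w \<in> V i. c w = a} = n i div k"
      if "i \<in> {1..p}" "a \<in> {1..k}" for i a
      using f_classes that by simp
    have "card {w \<in> neighborhood G v. c w = a} = card {w \<in> neighborhood G v. c w = b}"
      if "v \<in> verts G" "a \<in> {1..k}" "b \<in> {1..k}" for v a b
    proof -
      obtain i where i: "i \<in> {1..p}" and v: "v \<in> V i"
        using \<open>v \<in> verts G\<close> unfolding verts by blast
      have "card {w \<in> neighborhood G v. c w = d} = (\<Sum>j\<in>{1..p} - {i}. n j div k)"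
        if "d \<in> {1..k}" for d
        unfolding count[OF i v] using classes[OF _ that] by (intro sum.cong) auto
      with that(2,3) show ?thesis
        by simp
    qed
    with c have "neighborhood_balanced_coloring G k c"
      unfolding neighborhood_balanced_coloring_def by blast
    then show "\<exists>c. neighborhood_balanced_coloring G k c" by blast
  qed
qed

end
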